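(* Let $K$ be a field. For any $n\ge2$, the ring $R_n=R(K[X_1,\ldots,X_n])$ is not integrally closed (in its fraction field).
   Context: For an integral domain $T$, the reciprocal complement $R(T)$ is the subring of the fraction field of $T$ generated by all $1/f$ with $f\in T\setminus\{0\}$. Here $K[X_1,\ldots,X_n]$ is the polynomial ring in $n$ variables over $K$. *)

theory Defs
  imports
    "HOL-Library.Poly_Mapping"
    "HOL-Computational_Algebra.Polynomial"
    "HOL-Computational_Algebra.Fraction_Field"
begin

definition is_subring :: "'a::comm_ring_1 set \<Rightarrow> bool" where
  "is_subring A \<longleftrightarrow>
     0 \<in> A \<and> 1 \<in> A \<and> (\<forall>a\<in>A. - a \<in> A) \<and>
     (\<forall>a\<in>A. \<forall>b\<in>A. a + b \<in> A \<and> a * b \<in> A)"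

lemma is_subring_hull: "is_subring (is_subring hull S)"
  by (rule hull_in) (auto simp: is_subring_def)

(* T is a subring of a domain of type 'a, and the fraction field of T is identified with
   its canonical copy {f / g | f g. f \<in> T, g \<in> T - {0}} inside the fraction field of
   that larger domain. All generators lie in this copy, so the subring they generate does
   not depend on the ambient domain. *)
definition reciprocal_complement :: "'a::idom set \<Rightarrow> 'a fract set" where
  "reciprocal_complement T = is_subring hull {Fract 1 f | f. f \<in> T - {0}}"

(* The fraction field of a subring A of a field, as a subfield of that field. *)
definition fraction_field :: "'a::field set \<Rightarrow> 'a set" where
  "fraction_field A = {a / b | a b. a \<in> A \<and> b \<in> A \<and> b \<noteq> 0}"

definition integral_over :: "'a::comm_ring_1 set \<Rightarrow> 'a \<Rightarrow> bool" where
  "integral_over A x \<longleftrightarrow>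
     (\<exists>p. lead_coeff p = 1 \<and> (\<forall>i. coeff p i \<in> A) \<and> poly p x = 0)"

definition integrally_closed :: "'a::field set \<Rightarrow> bool" where
  "integrally_closed A \<longleftrightarrow> (\<forall>x \<in> fraction_field A. integral_over A x \<longrightarrow> x \<in> A)"

(* (nat \<Rightarrow>\<^sub>0 nat) \<Rightarrow>\<^sub>0 'k is the ring of polynomials over 'k in variables X_i indexed by all
   natural numbers i: the outer map sends exponent vectors (monomials) to coefficients.
   K[X_1, ..., X_n] consists of the polynomials all of whose monomials involve only
   variables with index in {1..n}. *)
definition polynomial_ring :: "nat \<Rightarrow> ((nat \<Rightarrow>\<^sub>0 nat) \<Rightarrow>\<^sub>0 'k::field) set" where
  "polynomial_ring n = {p. \<forall>m \<in> Poly_Mapping.keys p. Poly_Mapping.keys m \<subseteq> {1..n}}"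

lemma is_subring_polynomial_ring: "is_subring (polynomial_ring n)"
proof -
  have *: "Poly_Mapping.keys m \<subseteq> {1..n}"
    if "p \<in> polynomial_ring n" "q \<in> polynomial_ring n"
      and m: "m \<in> Poly_Mapping.keys (p * q)"
    for p q :: "(nat \<Rightarrow>\<^sub>0 nat) \<Rightarrow>\<^sub>0 'k::field" and m
  proof -
    obtain a b where "a \<in> Poly_Mapping.keys p" "b \<in> Poly_Mapping.keys q" "m = a + b"
      using m keys_mult[of p q] by blast
    then show ?thesis
      using that keys_add[of a b] unfolding polynomial_ring_def by blast
  qed
  show ?thesis
    unfolding is_subring_def
  proof (intro conjI ballI)
    show "p * q \<in> polynomial_ring n"
      if "p \<in> polynomial_ring n" "q \<in> polynomial_ring n"
      for p q :: "(nat \<Rightarrow>\<^sub>0 nat) \<Rightarrow>\<^sub>0 'k::field"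
      using *[OF that] by (simp add: polynomial_ring_def)
    show "p + q \<in> polynomial_ring n"
      if "p \<in> polynomial_ring n" "q \<in> polynomial_ring n"
      for p q :: "(nat \<Rightarrow>\<^sub>0 nat) \<Rightarrow>\<^sub>0 'k::field"
      using that keys_add[of p q] unfolding polynomial_ring_def by blast
  qed (simp_all add: polynomial_ring_def)
qed

end

theory Submission
  imports Defs "HOL-Computational_Algebra.Formal_Laurent_Series"
begin

text \<open>
  Write \<open>X\<close>, \<open>Y\<close> for the first two variables and \<open>t = Y\<^sup>2 - X\<^sup>3\<close>. Over the field generated by
  \<open>K\<close>, \<open>t\<close> and the other variables the curve \<open>Y\<^sup>2 = X\<^sup>3 + t\<close> has a single place at infinity,
  where \<open>X\<close> and \<open>Y\<close> have poles of order 2 and 3, and no polynomial has a pole of order exactly 1.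
  So in terms of the order \<open>v\<close> at this place a unit fraction \<open>1/f\<close> has \<open>v = 0\<close> or \<open>v \<ge> 2\<close>, and the whole reciprocal complement
  lies in the ring of all sums \<open>c + y\<close> with \<open>c\<close> a quotient of polynomials of order 0 (or
  \<open>c = 0\<close>) and \<open>v(y) \<ge> 2\<close>. That ring has no element of order 1
  (\<open>order_one_not_in_gap_ring\<close>). The element \<open>a = X/(Yt)\<close> has order 1, but
  \<open>a\<^sup>2 = 1/(t\<^sup>2 X) - 1/(t X Y\<^sup>2)\<close> is a difference of unit fractions
  (\<open>cusp_power2_eq\<close>), so \<open>a\<close> is integral over the reciprocal complement
  without belonging to it. The factor \<open>1/t\<close> does not change the order; it is there to make the
  square a sum of unit fractions.

  The order \<open>v\<close> is made explicit by a parametrization of the curve near infinity. With \<open>u = X/Y\<close> and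
  \<open>w = t Y\<^sup>4 / X\<^sup>6\<close> the equation of the curve gives
  \<open>X = u\<^sup>-\<^sup>2 (1 - w u\<^sup>6)\<close> and \<open>Y = u\<^sup>-\<^sup>3 (1 - w u\<^sup>6)\<close>, so polynomials become Laurent series in
  \<open>u\<close> whose coefficients are polynomials in \<open>w\<close> and the other variables, and \<open>v\<close> is the
  order in \<open>u\<close>. As \<open>t = w (1 - w u\<^sup>6)\<^sup>2\<close>, a nonzero polynomial in \<open>t\<close> has order 0. Every polynomial
  is \<open>A(X) + B(X) Y\<close> with coefficients that are polynomials in \<open>t\<close> and the other variables
  (\<open>normal_forms_UNIV\<close>); the two summands have orders of opposite parity, so nothing
  cancels between them, and the orders that occur are \<open>0, -2, -3, -4, \<dots>\<close> (\<open>param_order\<close>).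
\<close>

section \<open>Polynomials in several variables\<close>

abbreviation mconst :: "'k::field \<Rightarrow> (nat \<Rightarrow>\<^sub>0 nat) \<Rightarrow>\<^sub>0 'k" where
  "mconst \<equiv> Poly_Mapping.single 0"

definition mvar :: "nat \<Rightarrow> (nat \<Rightarrow>\<^sub>0 nat) \<Rightarrow>\<^sub>0 'k::field" where
  "mvar i = Poly_Mapping.single (Poly_Mapping.single i 1) 1"

lemma poly_mapping_additive_induct [case_names single add]:
  assumes single: "\<And>m a. P (Poly_Mapping.single m a)"
    and add: "\<And>p q. P p \<Longrightarrow> P q \<Longrightarrow> P (p + q)"
  shows "P (p :: 'a \<Rightarrow>\<^sub>0 'b::comm_monoid_add)"
proof -
  have "p = (\<Sum>m\<in>Poly_Mapping.keys p. Poly_Mapping.single m (Poly_Mapping.lookup p m))"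
    by (rule poly_mapping_eqI)
      (simp add: lookup_sum lookup_single when_def in_keys_iff)
  moreover have "P (\<Sum>m\<in>A. Poly_Mapping.single m (Poly_Mapping.lookup p m))" if "finite A" for A
    using that
  proof induction
    case empty
    then show ?case using single[of _ 0] by simp
  next
    case (insert m A)
    then show ?case by (simp add: single add)
  qed
  ultimately show ?thesis by (metis finite_keys)
qed

text \<open>A property of polynomials that survives multiplication by each variable survives
  multiplication by each monomial; hence constants, sums and variables suffice.\<close>

lemma mpoly_induct [case_names const add var_mult]:
  assumes const: "\<And>a. P (mconst a)"
    and add: "\<And>p q. P p \<Longrightarrow> P q \<Longrightarrow> P (p + q)"
    and var_mult: "\<And>i p. P p \<Longrightarrow> P (mvar i * p)"
  shows "P (p :: (nat \<Rightarrow>\<^sub>0 nat) \<Rightarrow>\<^sub>0 'k::field)"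
proof -
  have mono: "\<forall>p. P p \<longrightarrow> P (Poly_Mapping.single m 1 * p)" for m
  proof (induction m rule: poly_mapping_additive_induct)
    case (single i e)
    show ?case
    proof (induction e)
      case 0
      then show ?case by simp
    next
      case (Suc e)
      have "Poly_Mapping.single (Poly_Mapping.single i (Suc e)) 1
          = mvar i * Poly_Mapping.single (Poly_Mapping.single i e) (1::'k)"
        by (simp add: mvar_def mult_single single_add[symmetric])
      then show ?case using Suc var_mult by (simp add: mult.assoc)
    qed
  next
    case (add m m')
    have "Poly_Mapping.single (m + m') 1
        = Poly_Mapping.single m 1 * Poly_Mapping.single m' (1::'k)"
      by (simp add: mult_single)
    then show ?case using add by (simp add: mult.assoc)
  qed
  show ?thesis
  proof (induction p rule: poly_mapping_additive_induct)
    case (single m a)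
    have "Poly_Mapping.single m a = Poly_Mapping.single m 1 * mconst a"
      by (simp add: mult_single)
    then show ?case using mono const by metis
  next
    case (add p q)
    then show ?case by (rule assms(2))
  qed
qed

definition eval_monomial :: "(nat \<Rightarrow> 'b::comm_ring_1) \<Rightarrow> (nat \<Rightarrow>\<^sub>0 nat) \<Rightarrow> 'b" where
  "eval_monomial \<xi> m = (\<Prod>i\<in>Poly_Mapping.keys m. \<xi> i ^ Poly_Mapping.lookup m i)"

definition eval_mpoly ::
  "('k::field \<Rightarrow> 'b::comm_ring_1) \<Rightarrow> (nat \<Rightarrow> 'b) \<Rightarrow> ((nat \<Rightarrow>\<^sub>0 nat) \<Rightarrow>\<^sub>0 'k) \<Rightarrow> 'b" where
  "eval_mpoly c \<xi> p = (\<Sum>m\<in>Poly_Mapping.keys p. c (Poly_Mapping.lookup p m) * eval_monomial \<xi> m)"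

lemma eval_monomial_superset:
  assumes "finite A" "Poly_Mapping.keys m \<subseteq> A"
  shows "eval_monomial \<xi> m = (\<Prod>i\<in>A. \<xi> i ^ Poly_Mapping.lookup m i)"
  unfolding eval_monomial_def
  by (rule prod.mono_neutral_left) (use assms in \<open>auto simp: in_keys_iff\<close>)

lemma eval_monomial_add: "eval_monomial \<xi> (m + m') = eval_monomial \<xi> m * eval_monomial \<xi> m'"
proof -
  let ?A = "Poly_Mapping.keys m \<union> Poly_Mapping.keys m'"
  have "eval_monomial \<xi> (m + m') = (\<Prod>i\<in>?A. \<xi> i ^ Poly_Mapping.lookup (m + m') i)"
    by (rule eval_monomial_superset) (auto dest: subsetD[OF keys_add])
  also have "\<dots> = (\<Prod>i\<in>?A. \<xi> i ^ Poly_Mapping.lookup m i) * (\<Prod>i\<in>?A. \<xi> i ^ Poly_Mapping.lookup m' i)"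
    by (simp add: lookup_add power_add prod.distrib)
  also have "\<dots> = eval_monomial \<xi> m * eval_monomial \<xi> m'"
    by (simp add: eval_monomial_superset[of ?A])
  finally show ?thesis .
qed

locale coefficient_hom =
  fixes c :: "'k::field \<Rightarrow> 'b::comm_ring_1"
  assumes hom_0: "c 0 = 0" and hom_1: "c 1 = 1"
    and hom_add: "c (a + b) = c a + c b" and hom_mult: "c (a * b) = c a * c b"
begin

lemma eval_mpoly_superset:
  assumes "finite A" "Poly_Mapping.keys p \<subseteq> A"
  shows "eval_mpoly c \<xi> p = (\<Sum>m\<in>A. c (Poly_Mapping.lookup p m) * eval_monomial \<xi> m)"
  unfolding eval_mpoly_def
  by (rule sum.mono_neutral_left) (use assms in \<open>auto simp: in_keys_iff hom_0\<close>)

lemma eval_mpoly_single: "eval_mpoly c \<xi> (Poly_Mapping.single m a) = c a * eval_monomial \<xi> m"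
  by (subst eval_mpoly_superset[of "{m}"]) auto

lemma eval_mpoly_const: "eval_mpoly c \<xi> (mconst a) = c a"
  by (simp add: eval_mpoly_single eval_monomial_def)

lemma eval_mpoly_var: "eval_mpoly c \<xi> (mvar i) = \<xi> i"
  by (simp add: mvar_def eval_mpoly_single eval_monomial_def hom_1)

lemma eval_mpoly_0: "eval_mpoly c \<xi> 0 = 0"
  by (simp add: eval_mpoly_def)

lemma eval_mpoly_add: "eval_mpoly c \<xi> (p + q) = eval_mpoly c \<xi> p + eval_mpoly c \<xi> q"
proof -
  let ?A = "Poly_Mapping.keys p \<union> Poly_Mapping.keys q"
  have "eval_mpoly c \<xi> (p + q) = (\<Sum>m\<in>?A. c (Poly_Mapping.lookup (p + q) m) * eval_monomial \<xi> m)"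
    by (rule eval_mpoly_superset) (auto dest: subsetD[OF keys_add])
  also have "\<dots> = (\<Sum>m\<in>?A. c (Poly_Mapping.lookup p m) * eval_monomial \<xi> m)
      + (\<Sum>m\<in>?A. c (Poly_Mapping.lookup q m) * eval_monomial \<xi> m)"
    by (simp add: lookup_add hom_add distrib_right sum.distrib)
  also have "\<dots> = eval_mpoly c \<xi> p + eval_mpoly c \<xi> q"
    by (simp add: eval_mpoly_superset[of ?A])
  finally show ?thesis .
qed

lemma eval_mpoly_mult: "eval_mpoly c \<xi> (p * q) = eval_mpoly c \<xi> p * eval_mpoly c \<xi> q"
proof (induction p rule: poly_mapping_additive_induct)
  case (single m a)
  show ?case
    by (induction q rule: poly_mapping_additive_induct)
      (simp_all add: mult_single eval_mpoly_single eval_monomial_add hom_mult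
        eval_mpoly_add distrib_left mult.assoc mult.left_commute)
next
  case (add p p')
  then show ?case by (simp add: eval_mpoly_add distrib_right)
qed

lemma eval_mpoly_minus: "eval_mpoly c \<xi> (- p) = - eval_mpoly c \<xi> p"
  using eval_mpoly_add[of \<xi> p "- p"] by (simp add: eval_mpoly_0 minus_unique)

lemma eval_mpoly_diff: "eval_mpoly c \<xi> (p - q) = eval_mpoly c \<xi> p - eval_mpoly c \<xi> q"
  using eval_mpoly_add[of \<xi> p "- q"] by (simp add: eval_mpoly_minus)

lemma eval_mpoly_1: "eval_mpoly c \<xi> 1 = 1"
  using eval_mpoly_const[of \<xi> 1] by (simp add: hom_1)

lemma eval_mpoly_power: "eval_mpoly c \<xi> (p ^ n) = eval_mpoly c \<xi> p ^ n"
  by (induction n) (simp_all add: eval_mpoly_1 eval_mpoly_mult)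

end

section \<open>Orders that omit the value -1\<close>

text \<open>The sign convention is that of an order of vanishing, so polynomials have order at most 0. The
  value at 0 is left arbitrary, which is why a numerator that may be 0 is always treated separately
  below.\<close>

locale gap_order =
  fixes v :: "'a::idom \<Rightarrow> int"
  assumes mult: "f \<noteq> 0 \<Longrightarrow> g \<noteq> 0 \<Longrightarrow> v (f * g) = v f + v g"
    and add: "f \<noteq> 0 \<Longrightarrow> g \<noteq> 0 \<Longrightarrow> f + g \<noteq> 0 \<Longrightarrow> min (v f) (v g) \<le> v (f + g)"
    and nonpos: "f \<noteq> 0 \<Longrightarrow> v f \<le> 0"
    and gap: "f \<noteq> 0 \<Longrightarrow> v f \<noteq> -1"
begin

lemma one: "v 1 = 0"
  using mult[of 1 1] by simp

lemma uminus: "v (- f) = v f"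
proof (cases "f = 0")
  case False
  have "v (- 1) = 0" using mult[of "- 1" "- 1"] one by simp
  then show ?thesis using mult[of "- 1" f] False by simp
qed simp

definition order_ge :: "int \<Rightarrow> 'a fract set" where
  "order_ge k = {Fract p q | p q. q \<noteq> 0 \<and> (p \<noteq> 0 \<longrightarrow> v q + k \<le> v p)}"

definition order_zero_fracts :: "'a fract set" where
  "order_zero_fracts = {Fract c d | c d. d \<noteq> 0 \<and> v d = 0 \<and> (c \<noteq> 0 \<longrightarrow> v c = 0)}"

text \<open>Since \<open>v\<close> is additive on products, \<open>v p - v q\<close> is the same for all representations of a fraction.\<close>

lemma Fract_in_order_ge_iff:
  assumes "q \<noteq> 0"
  shows "Fract p q \<in> order_ge k \<longleftrightarrow> (p \<noteq> 0 \<longrightarrow> v q + k \<le> v p)"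
proof
  assume "Fract p q \<in> order_ge k"
  then obtain p' q' where *: "Fract p q = Fract p' q'" "q' \<noteq> 0" "p' \<noteq> 0 \<longrightarrow> v q' + k \<le> v p'"
    unfolding order_ge_def by blast
  then have eq: "p * q' = p' * q" using assms by (simp add: eq_fract)
  show "p \<noteq> 0 \<longrightarrow> v q + k \<le> v p"
  proof
    assume p: "p \<noteq> 0"
    then have p': "p' \<noteq> 0" using eq * by auto
    have "v p + v q' = v p' + v q" using eq p p' * assms by (metis mult)
    then show "v q + k \<le> v p" using * p' by linarith
  qed
qed (use assms in \<open>auto simp: order_ge_def\<close>)

lemma order_ge_add:
  assumes "x \<in> order_ge k" "y \<in> order_ge k"
  shows "x + y \<in> order_ge k"
proof -
  obtain p q r s where x: "x = Fract p q" "q \<noteq> 0" "p \<noteq> 0 \<longrightarrow> v q + k \<le> v p"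
    and y: "y = Fract r s" "s \<noteq> 0" "r \<noteq> 0 \<longrightarrow> v s + k \<le> v r"
    using assms unfolding order_ge_def by blast
  have "v (q * s) + k \<le> v (p * s + r * q)" if nz: "p * s + r * q \<noteq> 0"
  proof (cases "p = 0 \<or> r = 0")
    case True
    then show ?thesis using nz x y by (auto simp: mult)
  next
    case False
    then have "min (v (p * s)) (v (r * q)) \<le> v (p * s + r * q)"
      using nz x y by (intro add) auto
    then show ?thesis using False x y by (simp add: mult min_le_iff_disj) linarith
  qed
  then show ?thesis using x y by (simp add: Fract_in_order_ge_iff)
qed

lemma order_ge_uminus: "x \<in> order_ge k \<Longrightarrow> - x \<in> order_ge k"
  unfolding order_ge_def by (force simp: uminus)

lemma order_ge_mult:
  assumes "x \<in> order_ge j" "y \<in> order_ge k"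
  shows "x * y \<in> order_ge (j + k)"
proof -
  obtain p q r s where x: "x = Fract p q" "q \<noteq> 0" "p \<noteq> 0 \<longrightarrow> v q + j \<le> v p"
    and y: "y = Fract r s" "s \<noteq> 0" "r \<noteq> 0 \<longrightarrow> v s + k \<le> v r"
    using assms unfolding order_ge_def by blast
  then show ?thesis by (auto simp: Fract_in_order_ge_iff mult)
qed

lemma order_ge_mono: "j \<le> k \<Longrightarrow> order_ge k \<subseteq> order_ge j"
  unfolding order_ge_def by force

lemma order_zero_fracts_subset: "order_zero_fracts \<subseteq> order_ge 0"
  unfolding order_zero_fracts_def order_ge_def by force

text \<open>A sum of elements of order 0 has order at least 0 by the ultrametric inequality and at most 0 by
  nonpositivity. This makes the quotients of order 0, together with 0, a subring.\<close>

lemma order_zero_numerator_add: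
  assumes "c \<noteq> 0 \<longrightarrow> v c = 0" "d \<noteq> 0 \<longrightarrow> v d = 0" "c + d \<noteq> 0"
  shows "v (c + d) = 0"
  using assms add[of c d] nonpos[of "c + d"] by (cases "c = 0 \<or> d = 0") auto

lemma is_subring_order_zero_fracts: "is_subring order_zero_fracts"
  unfolding is_subring_def
proof (intro conjI ballI)
  show "0 \<in> order_zero_fracts"
    unfolding order_zero_fracts_def using one by (force simp: Zero_fract_def)
  show "1 \<in> order_zero_fracts"
    unfolding order_zero_fracts_def using one by (force simp: One_fract_def)
  show "- x \<in> order_zero_fracts" if "x \<in> order_zero_fracts" for x
    using that unfolding order_zero_fracts_def by (force simp: uminus)
next
  fix x y assume "x \<in> order_zero_fracts" "y \<in> order_zero_fracts"
  then obtain a b c d where x: "x = Fract a b" "b \<noteq> 0" "v b = 0" "a \<noteq> 0 \<longrightarrow> v a = 0"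
    and y: "y = Fract c d" "d \<noteq> 0" "v d = 0" "c \<noteq> 0 \<longrightarrow> v c = 0"
    unfolding order_zero_fracts_def by blast
  have "v (a * d + c * b) = 0" if "a * d + c * b \<noteq> 0"
    using that x y by (intro order_zero_numerator_add) (auto simp: mult)
  then show "x + y \<in> order_zero_fracts"
    using x y unfolding order_zero_fracts_def by (force simp: mult)
  show "x * y \<in> order_zero_fracts"
    using x y unfolding order_zero_fracts_def by (force simp: mult)
qed

text \<open>The quotients of order 0 play the part of the constants. With them the gap ring is the analogue of
  \<open>K[[u\<^sup>2, u\<^sup>3]]\<close> inside \<open>K[[u]]\<close>, where the term of order 1 is missing.\<close>

definition gap_ring :: "'a fract set" where
  "gap_ring = {x + y | x y. x \<in> order_zero_fracts \<and> y \<in> order_ge 2}"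

lemma is_subring_gap_ring: "is_subring gap_ring"
proof -
  have zero: "0 \<in> order_ge 2"
    unfolding order_ge_def Zero_fract_def by force
  note U = is_subring_order_zero_fracts[unfolded is_subring_def]
  show ?thesis unfolding is_subring_def
  proof (intro conjI ballI)
    show "0 \<in> gap_ring" "1 \<in> gap_ring"
      using U zero unfolding gap_ring_def mem_Collect_eq by (metis add.right_neutral)+
    show "- z \<in> gap_ring" if "z \<in> gap_ring" for z
      using that U order_ge_uminus unfolding gap_ring_def mem_Collect_eq
      by (metis minus_add_distrib)
  next
    fix z w assume "z \<in> gap_ring" "w \<in> gap_ring"
    then obtain x y x' y' where z: "z = x + y" "x \<in> order_zero_fracts" "y \<in> order_ge 2"
      and w: "w = x' + y'" "x' \<in> order_zero_fracts" "y' \<in> order_ge 2"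
      unfolding gap_ring_def by blast
    have "z + w = (x + x') + (y + y')" using z w by simp
    then show "z + w \<in> gap_ring"
      using z w U order_ge_add unfolding gap_ring_def by blast
    have "x * y' \<in> order_ge 2" "x' * y \<in> order_ge 2"
      using order_ge_mult[of _ 0 _ 2] order_zero_fracts_subset z w by auto
    moreover have "y * y' \<in> order_ge 2"
      using order_ge_mult[of y 2 y' 2] order_ge_mono[of 2 4] z w by auto
    ultimately have "x * y' + x' * y + y * y' \<in> order_ge 2" by (intro order_ge_add)
    moreover have "z * w = x * x' + (x * y' + x' * y + y * y')"
      using z w by (simp add: algebra_simps)
    ultimately show "z * w \<in> gap_ring"
      using z w U unfolding gap_ring_def by blast
  qed
qed

text \<open>This is where the gap enters: \<open>1/f\<close> has order \<open>- v f\<close>, which is 0 or at least 2.\<close>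

lemma reciprocal_complement_subset_gap_ring: "reciprocal_complement T \<subseteq> gap_ring"
  unfolding reciprocal_complement_def
proof (rule hull_minimal)
  show "{Fract 1 f | f. f \<in> T - {0}} \<subseteq> gap_ring"
  proof clarsimp
    fix f :: 'a assume f: "f \<noteq> 0"
    consider "v f = 0" | "v f + 2 \<le> 0" using nonpos[OF f] gap[OF f] by linarith
    then show "Fract 1 f \<in> gap_ring"
    proof cases
      case 1
      then have "Fract 1 f \<in> order_zero_fracts"
        unfolding order_zero_fracts_def using f one by blast
      moreover have "0 \<in> order_ge 2"
        unfolding order_ge_def Zero_fract_def by force
      ultimately show ?thesis unfolding gap_ring_def mem_Collect_eq by (metis add.right_neutral)
    next
      case 2
      then have "Fract 1 f \<in> order_ge 2" using f one by (simp add: Fract_in_order_ge_iff)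
      then show ?thesis
        using is_subring_order_zero_fracts unfolding gap_ring_def is_subring_def mem_Collect_eq
        by (metis add_0)
    qed
  qed
qed (rule is_subring_gap_ring)

text \<open>If \<open>p/q = x + y\<close> with \<open>x\<close> a constant and \<open>y\<close> of order at least 2, then \<open>x = 0\<close> would force \<open>p/q\<close> to
  have order at least 2, whereas \<open>x = p/q - y\<close> has order at least 1, which no nonzero constant has.\<close>

lemma order_one_not_in_gap_ring:
  assumes "p \<noteq> 0" "q \<noteq> 0" "v p = v q + 1"
  shows "Fract p q \<notin> gap_ring"
proof
  assume "Fract p q \<in> gap_ring"
  then obtain x y where xy: "Fract p q = x + y" "x \<in> order_zero_fracts" "y \<in> order_ge 2"
    unfolding gap_ring_def by blast
  obtain c d where x: "x = Fract c d" "d \<noteq> 0" "v d = 0" "c \<noteq> 0 \<longrightarrow> v c = 0"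
    using xy unfolding order_zero_fracts_def by blast
  have pq: "Fract p q \<in> order_ge 1" "Fract p q \<notin> order_ge 2"
    using assms by (auto simp: Fract_in_order_ge_iff)
  have "c \<noteq> 0"
    using pq xy x by (auto simp: fract_collapse)
  moreover have "y \<in> order_ge 1" using xy order_ge_mono[of 1 2] by auto
  then have "Fract p q + - y \<in> order_ge 1"
    using pq order_ge_add order_ge_uminus by blast
  then have "Fract c d \<in> order_ge 1" using xy x by simp
  ultimately show False using x by (simp add: Fract_in_order_ge_iff)
qed

end

section \<open>The place at infinity of a cuspidal pencil\<close>

text \<open>The target of the parametrization consists of Laurent series in \<open>u\<close> (the series variable) over
  polynomials in \<open>w\<close> (the polynomial variable \<open>[:0, 1:]\<close>), whose coefficients are in turn
  multivariate polynomials, so that the variables other than the first two can be sent to themselves.\<close>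

definition laurent_const :: "'k::field \<Rightarrow> ((nat \<Rightarrow>\<^sub>0 nat) \<Rightarrow>\<^sub>0 'k) poly fls" where
  "laurent_const a = fls_const [:mconst a:]"

definition unit_series :: "((nat \<Rightarrow>\<^sub>0 nat) \<Rightarrow>\<^sub>0 'k::field) poly fps" where
  "unit_series = 1 - fps_const [:0, 1:] * fps_X ^ 6"

text \<open>The first two lines solve \<open>Y\<^sup>2 = X\<^sup>3 + t\<close> near infinity with \<open>u = X/Y\<close>: substituting \<open>Y = X/u\<close>
  gives \<open>t = X\<^sup>2 (u\<^sup>-\<^sup>2 - X)\<close>, and putting \<open>X = u\<^sup>-\<^sup>2 (1 - V)\<close> turns this into
  \<open>t = u\<^sup>-\<^sup>6 V (1 - V)\<^sup>2\<close>, so that \<open>V = w u\<^sup>6\<close> removes the pole of \<open>t\<close>. No square root is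
  extracted, so the formulas hold in every characteristic.\<close>

definition parametrization :: "nat \<Rightarrow> ((nat \<Rightarrow>\<^sub>0 nat) \<Rightarrow>\<^sub>0 'k::field) poly fls" where
  "parametrization i =
     (if i = 1 then fls_X_inv ^ 2 * fps_to_fls unit_series
      else if i = 2 then fls_X_inv ^ 3 * fps_to_fls unit_series
      else fls_const [:mvar i:])"

abbreviation param :: "((nat \<Rightarrow>\<^sub>0 nat) \<Rightarrow>\<^sub>0 'k::field) \<Rightarrow> ((nat \<Rightarrow>\<^sub>0 nat) \<Rightarrow>\<^sub>0 'k) poly fls" where
  "param \<equiv> eval_mpoly laurent_const parametrization"

interpretation laurent_const: coefficient_hom "laurent_const :: 'k::field \<Rightarrow> _"
proof
  show "laurent_const (0 :: 'k) = 0" "laurent_const (1 :: 'k) = 1"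
    by (simp_all add: laurent_const_def one_pCons)
  show "laurent_const (a + b) = laurent_const a + laurent_const b" for a b :: 'k
    by (simp add: laurent_const_def single_add fls_plus_const)
  show "laurent_const (a * b) = laurent_const a * laurent_const b" for a b :: 'k
    using mult_single[of "0 :: nat \<Rightarrow>\<^sub>0 nat" a 0 b] by (simp add: laurent_const_def mult.commute)
qed

lemmas param_simps = laurent_const.eval_mpoly_const laurent_const.eval_mpoly_var
  laurent_const.eval_mpoly_0 laurent_const.eval_mpoly_1 laurent_const.eval_mpoly_add
  laurent_const.eval_mpoly_mult laurent_const.eval_mpoly_minus
  laurent_const.eval_mpoly_diff laurent_const.eval_mpoly_power

definition cusp_fibre :: "(nat \<Rightarrow>\<^sub>0 nat) \<Rightarrow>\<^sub>0 'k::field" where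
  "cusp_fibre = mvar 2 ^ 2 - mvar 1 ^ 3"

lemma param_cusp_fibre:
  "param cusp_fibre = fps_to_fls (fps_const [:0, 1:] * unit_series ^ 2)"
proof -
  let ?U = "fps_to_fls unit_series :: ((nat \<Rightarrow>\<^sub>0 nat) \<Rightarrow>\<^sub>0 'a) poly fls"
  have XX: "fls_X_inv * fls_X = (1 :: ((nat \<Rightarrow>\<^sub>0 nat) \<Rightarrow>\<^sub>0 'a) poly fls)"
    using fls_X_inv_times_conv_shift(1)[of "fls_X :: ((nat \<Rightarrow>\<^sub>0 nat) \<Rightarrow>\<^sub>0 'a) poly fls"]
    by (simp add: fls_X_conv_shift_1)
  have U: "?U = 1 - fls_const [:0, 1:] * fls_X ^ 6"
    by (simp add: unit_series_def fls_times_fps_to_fls fps_to_fls_power)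
  have "param cusp_fibre = (fls_X_inv ^ 3 * ?U) ^ 2 - (fls_X_inv ^ 2 * ?U) ^ 3"
    by (simp add: cusp_fibre_def param_simps parametrization_def)
  also have "\<dots> = fls_X_inv ^ 6 * ?U ^ 2 * (1 - ?U)"
    by (simp add: algebra_simps power2_eq_square power3_eq_cube eval_nat_numeral)
  also have "1 - ?U = fls_const [:0, 1:] * fls_X ^ 6" by (simp add: U)
  also have "fls_X_inv ^ 6 * ?U ^ 2 * (fls_const [:0, 1:] * fls_X ^ 6)
      = (fls_X_inv * fls_X) ^ 6 * (fls_const [:0, 1:] * ?U ^ 2)"
    by (simp only: power_mult_distrib mult_ac)
  also have "\<dots> = fps_to_fls (fps_const [:0, 1:] * unit_series ^ 2)"
    by (simp add: XX fls_times_fps_to_fls fps_to_fls_power)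
  finally show ?thesis .
qed

text \<open>Polynomials in the variables other than \<open>X\<close> and \<open>Y\<close>, characterized as the polynomials that the
  parametrization leaves unchanged.\<close>

definition base_coeffs :: "((nat \<Rightarrow>\<^sub>0 nat) \<Rightarrow>\<^sub>0 'k::field) set" where
  "base_coeffs = {b. param b = fls_const [:b:]}"

text \<open>The coefficient ring of the normal forms below; its nonzero elements are exactly the
  polynomials of order 0.\<close>

definition fibre_coeffs :: "((nat \<Rightarrow>\<^sub>0 nat) \<Rightarrow>\<^sub>0 'k::field) set" where
  "fibre_coeffs = {poly q cusp_fibre | q. \<forall>i. coeff q i \<in> base_coeffs}"

lemma is_subring_base_coeffs: "is_subring base_coeffs"
  unfolding is_subring_def base_coeffs_def
  by (auto simp: param_simps fls_plus_const mult.commute one_pCons simp flip: fls_const_uminus)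

lemma is_subring_poly_coeffs:
  assumes "is_subring A"
  shows "is_subring {q. \<forall>i. coeff q i \<in> A}"
proof -
  note A = assms[unfolded is_subring_def]
  have sum: "sum f I \<in> A" if "\<And>i. f i \<in> A" for f :: "nat \<Rightarrow> 'a" and I
    using that A by (induction I rule: infinite_finite_induct) auto
  show ?thesis
    using A sum unfolding is_subring_def by (auto simp: coeff_mult coeff_pCons split: nat.split)
qed

lemma is_subring_fibre_coeffs:
  "is_subring (fibre_coeffs :: ((nat \<Rightarrow>\<^sub>0 nat) \<Rightarrow>\<^sub>0 'k::field) set)"
proof -
  let ?Q = "{q :: ((nat \<Rightarrow>\<^sub>0 nat) \<Rightarrow>\<^sub>0 'k) poly. \<forall>i. coeff q i \<in> base_coeffs}"
  have Q: "is_subring ?Q"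
    by (rule is_subring_poly_coeffs[OF is_subring_base_coeffs])
  have image: "poly q cusp_fibre \<in> fibre_coeffs" if "q \<in> ?Q" for q
    using that unfolding fibre_coeffs_def by blast
  have preimage: "\<exists>q\<in>?Q. c = poly q cusp_fibre" if "c \<in> fibre_coeffs" for c
    using that unfolding fibre_coeffs_def by blast
  show ?thesis
    unfolding is_subring_def
  proof (intro conjI ballI)
    show "0 \<in> (fibre_coeffs :: ((nat \<Rightarrow>\<^sub>0 nat) \<Rightarrow>\<^sub>0 'k) set)"
      using image[of 0] Q unfolding is_subring_def poly_0 by blast
    show "1 \<in> (fibre_coeffs :: ((nat \<Rightarrow>\<^sub>0 nat) \<Rightarrow>\<^sub>0 'k) set)"
      using image[of 1] Q unfolding is_subring_def poly_1 by blast
  next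
    fix c :: "(nat \<Rightarrow>\<^sub>0 nat) \<Rightarrow>\<^sub>0 'k"
    assume "c \<in> fibre_coeffs"
    then obtain q where q: "q \<in> ?Q" "c = poly q cusp_fibre" using preimage by blast
    have "- q \<in> ?Q" using Q q(1) unfolding is_subring_def by blast
    from image[OF this] show "- c \<in> fibre_coeffs" by (simp add: q(2))
  next
    fix c d :: "(nat \<Rightarrow>\<^sub>0 nat) \<Rightarrow>\<^sub>0 'k"
    assume "c \<in> fibre_coeffs" "d \<in> fibre_coeffs"
    then obtain q r where q: "q \<in> ?Q" "c = poly q cusp_fibre"
      and r: "r \<in> ?Q" "d = poly r cusp_fibre"
      using preimage by meson
    have "q + r \<in> ?Q" "q * r \<in> ?Q" using Q q(1) r(1) unfolding is_subring_def by blast+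
    from this[THEN image] show "c + d \<in> fibre_coeffs" "c * d \<in> fibre_coeffs"
      by (simp_all add: q(2) r(2))
  qed
qed

lemma base_coeff_in_fibre_coeffs:
  assumes "b \<in> base_coeffs"
  shows "b \<in> fibre_coeffs"
  unfolding fibre_coeffs_def using assms is_subring_base_coeffs
  by (auto simp: is_subring_def coeff_pCons split: nat.split intro!: exI[of _ "[:b:]"])

lemma cusp_fibre_in_fibre_coeffs: "cusp_fibre \<in> fibre_coeffs"
  unfolding fibre_coeffs_def using is_subring_base_coeffs
  by (auto simp: is_subring_def coeff_pCons split: nat.split intro!: exI[of _ "[:0, 1:]"])

lemma mconst_in_base_coeffs: "mconst a \<in> base_coeffs"
  by (simp add: base_coeffs_def param_simps laurent_const_def)

lemma mvar_in_base_coeffs: "i \<noteq> 1 \<Longrightarrow> i \<noteq> 2 \<Longrightarrow> mvar i \<in> base_coeffs"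
  by (simp add: base_coeffs_def param_simps parametrization_def)

text \<open>At \<open>u = 0\<close> the series of \<open>t\<close> takes the value \<open>w\<close>, so the polynomial \<open>q\<close> in \<open>t\<close> takes the value
  \<open>q\<close>, read as a polynomial in \<open>w\<close>. In particular no nonzero \<open>q\<close> vanishes there.\<close>

lemma param_fibre_coeff:
  assumes "\<forall>i. coeff q i \<in> base_coeffs"
  shows "\<exists>F. param (poly q cusp_fibre) = fps_to_fls F \<and> fps_nth F 0 = q"
  using assms
proof (induction q)
  case 0
  then show ?case by (auto simp: param_simps intro!: exI[of _ 0])
next
  case (pCons b q)
  have b: "param b = fls_const [:b:]" and q: "\<forall>i. coeff q i \<in> base_coeffs"
    using spec[OF pCons.prems, of 0] pCons.prems 
    by (auto simp: base_coeffs_def coeff_pCons dest: spec[of _ "Suc _"])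
  then obtain F where F: "param (poly q cusp_fibre) = fps_to_fls F" "fps_nth F 0 = q"
    using pCons.IH by blast
  let ?G = "fps_const [:b:] + fps_const [:0, 1:] * unit_series ^ 2 * F"
  have "param (poly (pCons b q) cusp_fibre) = fps_to_fls ?G"
    by (simp add: param_simps b F param_cusp_fibre fls_times_fps_to_fls)
  moreover have "fps_nth ?G 0 = pCons b q"
    by (simp add: F unit_series_def fps_nth_power_0)
  ultimately show ?case by blast
qed

lemma param_fibre_coeff_order:
  assumes "c \<in> fibre_coeffs" "c \<noteq> 0"
  shows "param c \<noteq> 0 \<and> fls_subdegree (param c) = 0"
proof -
  obtain q where q: "c = poly q cusp_fibre" "\<forall>i. coeff q i \<in> base_coeffs"
    using assms unfolding fibre_coeffs_def by blast
  obtain F where F: "param c = fps_to_fls F" "fps_nth F 0 = q"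
    using param_fibre_coeff q by blast
  have "q \<noteq> 0" using assms q by auto
  then have "F \<noteq> 0" "subdegree F = 0" using F by (auto simp: subdegree_eq_0_iff)
  then show ?thesis using F by (simp add: fls_subdegree_fls_to_fps)
qed

lemma param_var1: "param (mvar 1 :: _ \<Rightarrow>\<^sub>0 'k::field) \<noteq> 0"
    "fls_subdegree (param (mvar 1 :: _ \<Rightarrow>\<^sub>0 'k)) = - 2"
  and param_var2: "param (mvar 2 :: _ \<Rightarrow>\<^sub>0 'k) \<noteq> 0"
    "fls_subdegree (param (mvar 2 :: _ \<Rightarrow>\<^sub>0 'k)) = - 3"
proof -
  have "fps_nth (unit_series :: ((nat \<Rightarrow>\<^sub>0 nat) \<Rightarrow>\<^sub>0 'k) poly fps) 0 = 1"
    by (simp add: unit_series_def)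
  then have U: "(unit_series :: ((nat \<Rightarrow>\<^sub>0 nat) \<Rightarrow>\<^sub>0 'k) poly fps) \<noteq> 0"
    "subdegree (unit_series :: ((nat \<Rightarrow>\<^sub>0 nat) \<Rightarrow>\<^sub>0 'k) poly fps) = 0"
    by (auto simp: subdegree_eq_0_iff)
  then show "param (mvar 1 :: _ \<Rightarrow>\<^sub>0 'k) \<noteq> 0"
    "fls_subdegree (param (mvar 1 :: _ \<Rightarrow>\<^sub>0 'k)) = - 2"
    "param (mvar 2 :: _ \<Rightarrow>\<^sub>0 'k) \<noteq> 0"
    "fls_subdegree (param (mvar 2 :: _ \<Rightarrow>\<^sub>0 'k)) = - 3"
    by (simp_all add: param_simps parametrization_def fls_subdegree_fls_to_fps)
qed

text \<open>Nonzero coefficients have order 0 and \<open>X\<close> has order \<open>-2\<close>, so the terms have distinct orders and the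
  leading one determines the order of the sum.\<close>

lemma param_poly_var1:
  fixes A :: "((nat \<Rightarrow>\<^sub>0 nat) \<Rightarrow>\<^sub>0 'k::field) poly"
  assumes "\<forall>i. coeff A i \<in> fibre_coeffs" "A \<noteq> 0"
  shows "param (poly A (mvar 1)) \<noteq> 0 \<and>
    fls_subdegree (param (poly A (mvar 1))) = - 2 * int (degree A)"
  using assms
proof (induction A)
  case (pCons c A)
  have c: "c \<in> fibre_coeffs" and A: "\<forall>i. coeff A i \<in> fibre_coeffs"
    using spec[OF pCons.prems(1), of 0] pCons.prems(1)
    by (auto simp: coeff_pCons dest: spec[of _ "Suc _"])
  show ?case
  proof (cases "A = 0")
    case True
    then show ?thesis using pCons c param_fibre_coeff_order by auto
  next
    case False
    let ?y = "param (mvar 1) * param (poly A (mvar 1))"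
    have y: "?y \<noteq> 0" "fls_subdegree ?y = - 2 * int (degree (pCons c A))"
      using False pCons.IH[OF A] param_var1[where 'k = 'k] by auto
    have *: "param (poly (pCons c A) (mvar 1)) = ?y + param c"
      by (simp add: param_simps)
    show ?thesis
    proof (cases "c = 0")
      case True
      then show ?thesis using y by (simp add: * param_simps)
    next
      case c0: False
      have "fls_subdegree ?y < fls_subdegree (param c)"
        using y(2) param_fibre_coeff_order[OF c c0] False by simp
      then have eq: "fls_subdegree (?y + param c) = fls_subdegree ?y"
        using y by (intro fls_subdegree_add_eq1)
      moreover have "fls_subdegree ?y \<noteq> 0" using y(2) False by simp
      ultimately have "?y + param c \<noteq> 0" by force
      then show ?thesis unfolding * eq y(2) by simp
    qed
  qed
qed simp

definition normal_forms :: "((nat \<Rightarrow>\<^sub>0 nat) \<Rightarrow>\<^sub>0 'k::field) set" where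
  "normal_forms = {poly A (mvar 1) + poly B (mvar 1) * mvar 2 | A B.
     (\<forall>i. coeff A i \<in> fibre_coeffs) \<and> (\<forall>i. coeff B i \<in> fibre_coeffs)}"

lemma normal_formsI:
  assumes "\<forall>i. coeff A i \<in> fibre_coeffs" "\<forall>i. coeff B i \<in> fibre_coeffs"
    and "p = poly A (mvar 1) + poly B (mvar 1) * mvar 2"
  shows "p \<in> normal_forms"
  using assms unfolding normal_forms_def by blast

text \<open>Multiplication by \<open>Y\<close> stays within the normal forms because of \<open>Y\<^sup>2 = X\<^sup>3 + t\<close>.\<close>

lemma normal_forms_UNIV:
  fixes p :: "(nat \<Rightarrow>\<^sub>0 nat) \<Rightarrow>\<^sub>0 'k::field"
  shows "p \<in> normal_forms"
proof (induction p rule: mpoly_induct)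
  note C = is_subring_fibre_coeffs[where 'k = 'k, unfolded is_subring_def]
  case (const a)
  show ?case
    using C base_coeff_in_fibre_coeffs[OF mconst_in_base_coeffs[of a]]
    by (intro normal_formsI[of "[:mconst a:]" 0]) (auto simp: coeff_pCons split: nat.split)
next
  note C = is_subring_fibre_coeffs[where 'k = 'k, unfolded is_subring_def]
  case (add p q)
  then obtain A B A' B' where
    "\<forall>i. coeff A i \<in> fibre_coeffs" "\<forall>i. coeff B i \<in> fibre_coeffs"
    "p = poly A (mvar 1) + poly B (mvar 1) * mvar 2"
    "\<forall>i. coeff A' i \<in> fibre_coeffs" "\<forall>i. coeff B' i \<in> fibre_coeffs"
    "q = poly A' (mvar 1) + poly B' (mvar 1) * mvar 2"
    unfolding normal_forms_def by blast
  then show ?case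
    using C by (intro normal_formsI[of "A + A'" "B + B'"]) (auto simp: algebra_simps)
next
  note C = is_subring_fibre_coeffs[where 'k = 'k, unfolded is_subring_def]
  case (var_mult i p)
  then obtain A B where AB: "\<forall>i. coeff A i \<in> fibre_coeffs" "\<forall>i. coeff B i \<in> fibre_coeffs"
    and p: "p = poly A (mvar 1) + poly B (mvar 1) * mvar 2"
    unfolding normal_forms_def by blast
  consider "i = 1" | "i = 2" | "i \<noteq> 1" "i \<noteq> 2" by blast
  then show ?case
  proof cases
    case 1
    show ?thesis
      using C AB unfolding p 1
      by (intro normal_formsI[of "pCons 0 A" "pCons 0 B"])
        (auto simp: algebra_simps coeff_pCons split: nat.split)
  next
    case 2
    let ?A = "pCons 0 (pCons 0 (pCons 0 B)) + smult cusp_fibre B"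
    have sq: "mvar 2 * mvar 2 = mvar 1 * (mvar 1 * mvar 1) + (cusp_fibre :: _ \<Rightarrow>\<^sub>0 'k)"
      by (simp add: cusp_fibre_def power2_eq_square power3_eq_cube mult.assoc)
    have "mvar 2 * p = mvar 2 * mvar 2 * poly B (mvar 1) + poly A (mvar 1) * mvar 2"
      unfolding p by (simp only: distrib_left mult_ac add_ac)
    also have "\<dots> = poly ?A (mvar 1) + poly A (mvar 1) * mvar 2"
      unfolding sq by (simp add: distrib_left distrib_right mult_ac)
    finally have "mvar 2 * p = poly ?A (mvar 1) + poly A (mvar 1) * mvar 2" .
    moreover have "\<forall>i. coeff ?A i \<in> fibre_coeffs"
      using C AB cusp_fibre_in_fibre_coeffs by (auto simp: coeff_pCons split: nat.split)
    ultimately show ?thesis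
      using AB unfolding 2 by (intro normal_formsI)
  next
    case 3
    then have "mvar i \<in> fibre_coeffs"
      by (intro base_coeff_in_fibre_coeffs mvar_in_base_coeffs)
    then show ?thesis
      using C AB unfolding p
      by (intro normal_formsI[of "smult (mvar i) A" "smult (mvar i) B"])
        (auto simp: distrib_left mult.assoc)
  qed
qed

text \<open>In the normal form \<open>A(X) + B(X) Y\<close> the first summand has the even order \<open>-2 deg A\<close> and the second
  the odd order \<open>-2 deg B - 3\<close>. The order of their sum is the smaller one, and \<open>-1\<close> is neither even
  nor at most \<open>-3\<close>.\<close>

lemma param_order:
  assumes "p \<noteq> 0"
  shows "param p \<noteq> 0 \<and> fls_subdegree (param p) \<le> 0 \<and> fls_subdegree (param p) \<noteq> - 1"
proof -
  obtain A B where AB: "\<forall>i. coeff A i \<in> fibre_coeffs" "\<forall>i. coeff B i \<in> fibre_coeffs"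
    and p: "p = poly A (mvar 1) + poly B (mvar 1) * mvar 2"
    using normal_forms_UNIV[of p] unfolding normal_forms_def by blast
  let ?a = "param (poly A (mvar 1))" and ?b = "param (poly B (mvar 1)) * param (mvar 2)"
  have pab: "param p = ?a + ?b" by (simp add: p param_simps)
  have a: "?a \<noteq> 0" "fls_subdegree ?a = - 2 * int (degree A)" if "A \<noteq> 0"
    using param_poly_var1 AB that by auto
  have b: "?b \<noteq> 0" "fls_subdegree ?b = - 2 * int (degree B) - 3" if "B \<noteq> 0"
    using param_poly_var1[OF AB(2) that] param_var2[where 'k = 'a] by auto
  consider "A = 0" "B \<noteq> 0" | "A \<noteq> 0" "B = 0" | "A \<noteq> 0" "B \<noteq> 0" using assms p by force
  then show ?thesis
  proof cases
    case 1
    then have "param p = ?b" by (simp add: pab param_simps)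
    then show ?thesis using b[OF 1(2)] by simp
  next
    case 2
    then have "param p = ?a" by (simp add: pab param_simps)
    moreover have "- 2 * int (degree A) \<le> 0 \<and> - 2 * int (degree A) \<noteq> - 1" by presburger
    ultimately show ?thesis using a[OF 2(1)] by simp
  next
    case 3
    have ne: "fls_subdegree ?a \<noteq> fls_subdegree ?b"
      unfolding a(2)[OF 3(1)] b(2)[OF 3(2)] by presburger
    have "?a + ?b \<noteq> 0"
    proof
      assume "?a + ?b = 0"
      then have "?b = - ?a" by (simp add: add_eq_0_iff)
      then show False using ne by (metis fls_uminus_subdegree)
    qed
    moreover have "fls_subdegree (?a + ?b) = min (fls_subdegree ?a) (fls_subdegree ?b)"
    proof (cases "fls_subdegree ?a < fls_subdegree ?b")
      case True
      then show ?thesis using fls_subdegree_add_eq1[OF a(1)[OF 3(1)] True] by simp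
    next
      case False
      then have "fls_subdegree ?b < fls_subdegree ?a" using ne by simp
      then show ?thesis using fls_subdegree_add_eq2[OF b(1)[OF 3(2)], of ?a] by simp
    qed
    ultimately show ?thesis
      unfolding pab a(2)[OF 3(1)] b(2)[OF 3(2)] by (simp add: min_def)
  qed
qed

interpretation cusp: gap_order "\<lambda>p :: (nat \<Rightarrow>\<^sub>0 nat) \<Rightarrow>\<^sub>0 'k::field. fls_subdegree (param p)"
proof
  fix f g :: "(nat \<Rightarrow>\<^sub>0 nat) \<Rightarrow>\<^sub>0 'k"
  assume f: "f \<noteq> 0"
  show "fls_subdegree (param f) \<le> 0" "fls_subdegree (param f) \<noteq> - 1"
    using param_order[OF f] by auto
  assume g: "g \<noteq> 0"
  show "fls_subdegree (param (f * g)) = fls_subdegree (param f) + fls_subdegree (param g)"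
    using param_order[OF f] param_order[OF g] by (simp add: param_simps)
  assume "f + g \<noteq> 0"
  then show "min (fls_subdegree (param f)) (fls_subdegree (param g))
      \<le> fls_subdegree (param (f + g))"
    using param_order[of "f + g"] fls_plus_subdegree[of "param f" "param g"]
    by (simp add: param_simps)
qed

section \<open>An integral element outside the reciprocal complement\<close>

lemma is_subring_reciprocal_complement: "is_subring (reciprocal_complement T)"
  unfolding reciprocal_complement_def by (rule is_subring_hull)

lemma Fract_one_in_reciprocal_complement:
  "f \<in> T \<Longrightarrow> f \<noteq> 0 \<Longrightarrow> Fract 1 f \<in> reciprocal_complement T"
  unfolding reciprocal_complement_def by (rule hull_inc) blast

lemma integral_over_if_power2_mem:
  assumes "is_subring A" "x ^ 2 \<in> A"
  shows "integral_over A x"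
  unfolding integral_over_def
proof (intro exI conjI allI)
  show "lead_coeff [:- (x ^ 2), 0, 1:] = 1" by simp
  show "coeff [:- (x ^ 2), 0, 1:] i \<in> A" for i
    using assms by (auto simp: is_subring_def coeff_pCons split: nat.split)
  show "poly [:- (x ^ 2), 0, 1:] x = 0" by (simp add: power2_eq_square)
qed

text \<open>From \<open>X\<^sup>3 = Y\<^sup>2 - t\<close> follows \<open>X\<^sup>2/Y\<^sup>2 = (Y\<^sup>2 - t)/(X Y\<^sup>2) = 1/X - t/(X Y\<^sup>2)\<close>; dividing by \<open>t\<^sup>2\<close>
  cancels the numerator \<open>t\<close>.\<close>

lemma cusp_power2_eq:
  assumes "X \<noteq> 0" "Y \<noteq> 0" "t \<noteq> 0" "t = Y ^ 2 - X ^ 3"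
  shows "Fract X (Y * t) ^ 2 = Fract 1 (t * (t * X)) - Fract 1 (t * (X * Y ^ 2))"
proof -
  have X: "X ^ 3 = Y ^ 2 - t" using assms by simp
  have "X ^ 2 * (t * (t * X) * (t * (X * Y ^ 2))) = t ^ 3 * X * Y ^ 2 * X ^ 3"
    by (simp add: power2_eq_square power3_eq_cube mult_ac)
  also have "\<dots> = (t * (X * Y ^ 2) - t * (t * X)) * (Y * t) ^ 2"
    unfolding X by (simp add: power2_eq_square power3_eq_cube algebra_simps)
  finally show ?thesis
    using assms(1-3) by (simp add: eq_fract power2_eq_square)
qed

lemma mvar_in_polynomial_ring: "1 \<le> i \<Longrightarrow> i \<le> n \<Longrightarrow> mvar i \<in> polynomial_ring n"
  by (simp add: mvar_def polynomial_ring_def)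

theorem theorem5p8:
  fixes n :: nat
  assumes "n \<ge> 2"
  shows "\<not> integrally_closed
    (reciprocal_complement (polynomial_ring n :: ((nat \<Rightarrow>\<^sub>0 nat) \<Rightarrow>\<^sub>0 'k::field) set))"
proof
  let ?T = "polynomial_ring n :: ((nat \<Rightarrow>\<^sub>0 nat) \<Rightarrow>\<^sub>0 'k) set"
  let ?R = "reciprocal_complement ?T"
  define X Y t :: "(nat \<Rightarrow>\<^sub>0 nat) \<Rightarrow>\<^sub>0 'k"
    where "X = mvar 1" and "Y = mvar 2" and "t = cusp_fibre"
  have t_eq: "t = Y ^ 2 - X ^ 3" by (simp add: X_def Y_def t_def cusp_fibre_def)
  have pX: "param X \<noteq> 0" "fls_subdegree (param X) = - 2"
    and pY: "param Y \<noteq> 0" "fls_subdegree (param Y) = - 3"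
    using param_var1 param_var2 by (simp_all add: X_def Y_def)
  have t1: "param t = fps_to_fls (fps_const [:0, 1:] * unit_series ^ 2)"
    unfolding t_def by (rule param_cusp_fibre)
  have "fps_nth (fps_const [:0, 1:] * unit_series ^ 2 ::
      ((nat \<Rightarrow>\<^sub>0 nat) \<Rightarrow>\<^sub>0 'k) poly fps) 0 \<noteq> 0"
    by (simp add: unit_series_def fps_nth_power_0)
  then have "param t \<noteq> 0" unfolding t1 by (metis fps_to_fls_eq_0_iff fps_zero_nth)
  then have nz: "X \<noteq> 0" "Y \<noteq> 0" "t \<noteq> 0" using pX pY by (auto simp: param_simps)
  have pt: "fls_subdegree (param t) = 0"
    using param_fibre_coeff_order[OF _ nz(3)] unfolding t_def
    by (simp add: cusp_fibre_in_fibre_coeffs)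
  note T = is_subring_polynomial_ring[of n, where 'a = 'k, unfolded is_subring_def]
  note R = is_subring_reciprocal_complement[of ?T, unfolded is_subring_def]
  have X: "X \<in> ?T" and Y: "Y \<in> ?T"
    using assms by (simp_all add: X_def Y_def mvar_in_polynomial_ring)
  have t: "t \<in> ?T"
  proof -
    have "Y * Y + - (X * X * X) \<in> ?T" using T X Y by blast
    then show ?thesis by (simp add: t_eq power2_eq_square power3_eq_cube)
  qed
  have inverse_mem: "Fract 1 f \<in> ?R" if "f \<in> ?T" "f \<noteq> 0" for f
    using that by (rule Fract_one_in_reciprocal_complement)
  let ?a = "Fract X (Y * t)"
  assume "integrally_closed ?R"
  moreover have "?a \<in> fraction_field ?R"
  proof -
    have "?a = Fract 1 (Y * t) / Fract 1 X" by simp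
    moreover have "Fract 1 X \<noteq> 0" using nz by (simp add: Zero_fract_def eq_fract)
    moreover have "Fract 1 (Y * t) \<in> ?R" "Fract 1 X \<in> ?R"
      using T X Y t nz by (auto intro!: inverse_mem)
    ultimately show ?thesis unfolding fraction_field_def by blast
  qed
  moreover have "integral_over ?R ?a"
  proof (rule integral_over_if_power2_mem)
    have "Fract 1 (t * (t * X)) \<in> ?R" "Fract 1 (t * (X * Y ^ 2)) \<in> ?R"
      using T X Y t nz by (auto intro!: inverse_mem simp: power2_eq_square)
    then show "?a ^ 2 \<in> ?R"
      unfolding cusp_power2_eq[OF nz t_eq] diff_conv_add_uminus using R by blast
  qed (rule is_subring_reciprocal_complement)
  ultimately have "?a \<in> ?R" unfolding integrally_closed_def by blast
  then have "?a \<in> cusp.gap_ring" using cusp.reciprocal_complement_subset_gap_ring by blast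
  moreover have "?a \<notin> cusp.gap_ring"
    using nz pX pY pt \<open>param t \<noteq> 0\<close>
    by (intro cusp.order_one_not_in_gap_ring) (auto simp: param_simps)
  ultimately show False by contradiction
qed

end
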